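(* There is a $g \in \operatorname{Perm}$ such that the problem $\mathrm{Conj}(g)$ is recursively unsolvable: there is no algorithm which, given a program for an arbitrary $f \in \operatorname{Perm}$ together with a decider for the cycle equivalence $\equiv_f$, correctly decides whether $f \sim g$.
   Context: $\mathcal{G}$ is the group of recursive permutations of $\mathbb{N}$; $x\equiv_f x'$ means $x' = f^k(x)$ for some $k\in\mathbb{Z}$. $\operatorname{Perm}$ is the set of $f\in\mathcal{G}$ for which $\equiv_f$ is decidable (a decider is a total recursive function computing the truth value of $x\equiv_f x'$). $f \sim g$ means there is $h\in\mathcal{G}$ with $f = h^{-1}gh$. *)

theory Defs
  imports Main "HOL-Library.Nat_Bijection"
begin

section \<open>Partial recursive functions and their programs\<close>

text \<open>
  Programs for the partial recursive functions of one argument. Several arguments are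
  passed as a single number by Cantor pairing (\<^const>\<open>prod_encode\<close>), so the projections and
  tuple formation are basic operations; the identity is \<open>Tuple Proj1 Proj2\<close>.
\<close>

datatype prog =
    Zero
  | Succ
  | Proj1
  | Proj2
  | Tuple prog prog
  | Comp prog prog
  | PrimRec prog prog
  | Mu prog

text \<open>
  \<open>eval p x y\<close>: program \<open>p\<close> halts on input \<open>x\<close> with output \<open>y\<close>. In \<open>Mu\<close>, the search for a
  zero of \<open>p(x, -)\<close> diverges if \<open>p\<close> diverges at some argument before the first zero.
\<close>

inductive eval :: "prog \<Rightarrow> nat \<Rightarrow> nat \<Rightarrow> bool" where
  Zero: "eval Zero x 0"
| Succ: "eval Succ x (Suc x)"
| Proj1: "eval Proj1 (prod_encode (x, y)) x"
| Proj2: "eval Proj2 (prod_encode (x, y)) y"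
| Tuple: "eval p x y \<Longrightarrow> eval q x z \<Longrightarrow> eval (Tuple p q) x (prod_encode (y, z))"
| Comp: "eval q x y \<Longrightarrow> eval p y z \<Longrightarrow> eval (Comp p q) x z"
| PrimRec_0: "eval p x y \<Longrightarrow> eval (PrimRec p q) (prod_encode (x, 0)) y"
| PrimRec_Suc: "eval (PrimRec p q) (prod_encode (x, n)) r \<Longrightarrow>
    eval q (prod_encode (x, prod_encode (n, r))) y \<Longrightarrow>
    eval (PrimRec p q) (prod_encode (x, Suc n)) y"
| Mu: "eval p (prod_encode (x, m)) 0 \<Longrightarrow>
    (\<forall>i<m. \<exists>y. eval p (prod_encode (x, i)) (Suc y)) \<Longrightarrow>
    eval (Mu p) x m"

lemma eval_deterministic: "eval p x y \<Longrightarrow> eval p x z \<Longrightarrow> y = z"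
proof (induction arbitrary: z rule: eval.induct)
  case (Mu p x m)
  from Mu.prems obtain "eval p (prod_encode (x, z)) 0"
    and "\<forall>i<z. \<exists>y. eval p (prod_encode (x, i)) (Suc y)"
    by (auto elim: eval.cases)
  with Mu.IH show ?case
    by (metis linorder_neqE_nat nat.distinct(1))
next
  case (Zero x)
  then show ?case by (auto elim: eval.cases)
next
  case (Succ x)
  then show ?case by (auto elim: eval.cases)
next
  case (Proj1 x y)
  then show ?case by (auto elim: eval.cases)
next
  case (Proj2 x y)
  then show ?case by (auto elim: eval.cases)
next
  case (Tuple p x y q z')
  from Tuple.prems show ?case by (rule eval.cases) (use Tuple.IH in auto)
next
  case (Comp q x y p z')
  from Comp.prems show ?case by (rule eval.cases) (use Comp.IH in auto)
next
  case (PrimRec_0 p x y q)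
  from PrimRec_0.prems show ?case by (rule eval.cases) (use PrimRec_0.IH in auto)
next
  case (PrimRec_Suc p q x n r y)
  from PrimRec_Suc.prems show ?case by (rule eval.cases) (use PrimRec_Suc.IH in auto)
qed

text \<open>Goedel numbering, by which programs are given as inputs to programs.\<close>

primrec goedel :: "prog \<Rightarrow> nat" where
  "goedel Zero = prod_encode (0, 0)"
| "goedel Succ = prod_encode (1, 0)"
| "goedel Proj1 = prod_encode (2, 0)"
| "goedel Proj2 = prod_encode (3, 0)"
| "goedel (Tuple p q) = prod_encode (4, prod_encode (goedel p, goedel q))"
| "goedel (Comp p q) = prod_encode (5, prod_encode (goedel p, goedel q))"
| "goedel (PrimRec p q) = prod_encode (6, prod_encode (goedel p, goedel q))"
| "goedel (Mu p) = prod_encode (7, goedel p)"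

lemma goedel_inject: "goedel p = goedel q \<longleftrightarrow> p = q"
proof (induction p arbitrary: q)
  case Zero then show ?case by (cases q) auto
next
  case Succ then show ?case by (cases q) auto
next
  case Proj1 then show ?case by (cases q) auto
next
  case Proj2 then show ?case by (cases q) auto
next
  case (Tuple p1 p2) then show ?case by (cases q) auto
next
  case (Comp p1 p2) then show ?case by (cases q) auto
next
  case (PrimRec p1 p2) then show ?case by (cases q) auto
next
  case (Mu p) then show ?case by (cases q) auto
qed

definition computes :: "prog \<Rightarrow> (nat \<Rightarrow> nat) \<Rightarrow> bool" where
  "computes p f \<longleftrightarrow> (\<forall>x. eval p x (f x))"

definition recursive :: "(nat \<Rightarrow> nat) \<Rightarrow> bool" where
  "recursive f \<longleftrightarrow> (\<exists>p. computes p f)"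

definition decides :: "prog \<Rightarrow> (nat \<Rightarrow> nat \<Rightarrow> bool) \<Rightarrow> bool" where
  "decides d R \<longleftrightarrow> (\<forall>x y. eval d (prod_encode (x, y)) (of_bool (R x y)))"

section \<open>Recursive permutations\<close>

text \<open>The inverse of a recursive permutation is again recursive, so this is a group.\<close>

definition rec_perms :: "(nat \<Rightarrow> nat) set" where
  "rec_perms = {f. bij f \<and> recursive f}"

definition int_iter :: "(nat \<Rightarrow> nat) \<Rightarrow> int \<Rightarrow> nat \<Rightarrow> nat" where
  "int_iter f k = (if k \<ge> 0 then f ^^ nat k else inv f ^^ nat (- k))"

definition cycle_equiv :: "(nat \<Rightarrow> nat) \<Rightarrow> nat \<Rightarrow> nat \<Rightarrow> bool" where
  "cycle_equiv f x x' \<longleftrightarrow> (\<exists>k. x' = int_iter f k x)"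

definition Perm :: "(nat \<Rightarrow> nat) set" where
  "Perm = {f \<in> rec_perms. \<exists>d. decides d (cycle_equiv f)}"

definition rec_conj :: "(nat \<Rightarrow> nat) \<Rightarrow> (nat \<Rightarrow> nat) \<Rightarrow> bool" where
  "rec_conj f g \<longleftrightarrow> (\<exists>h \<in> rec_perms. f = inv h \<circ> g \<circ> h)"

text \<open>
  \<open>A\<close> solves \<open>Conj(g)\<close>. This is a promise problem: nothing is required of \<open>A\<close> on pairs that are
  not (a program for some \<open>f \<in> Perm\<close>, a decider for the cycle equivalence of that \<open>f\<close>).
\<close>

definition solves_Conj :: "prog \<Rightarrow> (nat \<Rightarrow> nat) \<Rightarrow> bool" where
  "solves_Conj A g \<longleftrightarrow>
    (\<forall>f \<in> Perm. \<forall>p d. computes p f \<longrightarrow> decides d (cycle_equiv f) \<longrightarrow>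
      eval A (prod_encode (goedel p, goedel d)) (of_bool (rec_conj f g)))"

end

theory Submission
  imports Defs
begin

text \<open>
  The identity already has an unsolvable conjugacy problem: its conjugacy class is \<open>{id}\<close>, and
  whether \<open>f = id\<close> cannot be decided. Given a program \<open>A\<close>, self-reference in the style of
  Kleene's recursion theorem yields a program for an involution \<open>f\<close>, together with a decider for
  its cycles, such that \<open>f\<close> moves some point in its \<open>s\<close>-th block of numbers exactly if \<open>A\<close>, run
  with fuel \<open>s\<close> on precisely these two programs, answers that \<open>f \<sim> id\<close>. Hence \<open>f \<noteq> id\<close> if and
  only if \<open>A\<close> claims \<open>f \<sim> id\<close>. The cycle equivalence of an involution is decidable
  uniformly, since the orbit of \<open>x\<close> is \<open>{x, f x}\<close>.
\<close>

section \<open>Closure properties of recursive functions\<close>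

abbreviation pfst :: "nat \<Rightarrow> nat" where "pfst x \<equiv> fst (prod_decode x)"
abbreviation psnd :: "nat \<Rightarrow> nat" where "psnd x \<equiv> snd (prod_decode x)"

lemma eval_Proj1: "eval Proj1 x (pfst x)"
  by (metis eval.Proj1 prod.collapse prod_decode_inverse)

lemma eval_Proj2: "eval Proj2 x (psnd x)"
  by (metis eval.Proj2 prod.collapse prod_decode_inverse)

abbreviation Ident :: prog where "Ident \<equiv> Tuple Proj1 Proj2"

lemma eval_Ident: "eval Ident x x"
  using eval.Tuple[OF eval_Proj1 eval_Proj2, of x] by simp

named_theorems recursive_intros

lemma recursive_compose: "recursive f \<Longrightarrow> recursive g \<Longrightarrow> recursive (\<lambda>x. f (g x))"
  unfolding recursive_def computes_def by (meson eval.Comp)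

lemma recursive_ident [recursive_intros]: "recursive (\<lambda>x. x)"
  unfolding recursive_def computes_def by (meson eval_Ident)

lemma recursive_Suc [recursive_intros]: "recursive f \<Longrightarrow> recursive (\<lambda>x. Suc (f x))"
  by (rule recursive_compose) (auto simp: recursive_def computes_def intro: eval.Succ)

lemma recursive_const [recursive_intros]: "recursive (\<lambda>x. c)"
proof (induction c)
  case 0
  show ?case by (auto simp: recursive_def computes_def intro: eval.Zero)
qed (rule recursive_Suc)

lemma recursive_pfst [recursive_intros]: "recursive f \<Longrightarrow> recursive (\<lambda>x. pfst (f x))"
  by (rule recursive_compose[where f = pfst])
    (auto simp: recursive_def computes_def intro: eval_Proj1)

text \<open>Serves the steps of \<open>rec_nat\<close>, which receive input, counter and previous
  value as one nested pair: a function of the input alone is read off the first component.\<close>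

lemma recursive_compose_pfst: "recursive f \<Longrightarrow> recursive (\<lambda>w. f (pfst w))"
  using recursive_compose recursive_pfst[OF recursive_ident] by blast

lemma recursive_psnd [recursive_intros]: "recursive f \<Longrightarrow> recursive (\<lambda>x. psnd (f x))"
  by (rule recursive_compose[where f = psnd])
    (auto simp: recursive_def computes_def intro: eval_Proj2)

lemma recursive_prod_encode [recursive_intros]:
  "recursive f \<Longrightarrow> recursive g \<Longrightarrow> recursive (\<lambda>x. prod_encode (f x, g x))"
  unfolding recursive_def computes_def by (meson eval.Tuple)

lemma recursive_rec_nat [recursive_intros]:
  assumes b: "recursive b" and n: "recursive n"
    and g: "recursive (\<lambda>w. g (pfst w) (pfst (psnd w)) (psnd (psnd w)))"
  shows "recursive (\<lambda>x. rec_nat (b x) (\<lambda>i r. g x i r) (n x))"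
proof -
  obtain p q where p: "\<And>x. eval p x (b x)"
    and q: "\<And>w. eval q w (g (pfst w) (pfst (psnd w)) (psnd (psnd w)))"
    using b g unfolding recursive_def computes_def by blast
  have "eval (PrimRec p q) (prod_encode (x, k)) (rec_nat (b x) (g x) k)" for x k
  proof (induction k)
    case 0
    show ?case using p by (auto intro: eval.PrimRec_0)
  next
    case (Suc k)
    then show ?case
      using q[of "prod_encode (x, prod_encode (k, rec_nat (b x) (g x) k))"]
      by (auto intro: eval.PrimRec_Suc)
  qed
  then have "eval (PrimRec p q) w (rec_nat (b (pfst w)) (g (pfst w)) (psnd w))" for w
    by (metis prod.collapse prod_decode_inverse)
  then have "recursive (\<lambda>w. rec_nat (b (pfst w)) (g (pfst w)) (psnd w))"
    unfolding recursive_def computes_def by blast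
  from recursive_compose[OF this, of "\<lambda>x. prod_encode (x, n x)"] show ?thesis
    using n by (simp add: recursive_intros)
qed

lemma recursive_diff [recursive_intros]:
  assumes "recursive f" and "recursive g"
  shows "recursive (\<lambda>x. f x - g x)"
proof -
  have pred: "recursive (\<lambda>x. h x - Suc 0)" if "recursive h" for h
  proof -
    have "k - Suc 0 = rec_nat 0 (\<lambda>i r. i) k" for k by (cases k) auto
    then show ?thesis using that by (auto intro!: recursive_intros)
  qed
  have rec: "m - n = rec_nat m (\<lambda>i r. r - Suc 0) n" for m n :: nat
    by (induction n) (simp_all add: diff_Suc split: nat.split)
  show ?thesis
    using assms by (subst rec) (intro recursive_intros pred)
qed

text \<open>Branching is a recursion with constant step, which retains only whether its counter is
  0.\<close>

lemma recursive_if_zero: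
  assumes "recursive c" and "recursive f" and "recursive g"
  shows "recursive (\<lambda>x. if c x = 0 then f x else g x)"
proof -
  have rec: "(if k = 0 then a else b) = rec_nat a (\<lambda>i r. b) k" for k a b :: nat
    by (cases k) auto
  show ?thesis
    using assms by (subst rec) (intro recursive_intros recursive_compose_pfst)
qed

lemma recursive_if_eq [recursive_intros]:
  assumes "recursive a" and "recursive b" and "recursive f" and "recursive g"
  shows "recursive (\<lambda>x. if a x = b x then f x else g x)"
proof -
  \<comment> \<open>Subtraction is truncated, so equality means that both differences
    vanish.\<close>
  have "(\<lambda>x. if a x = b x then f x else g x) =
      (\<lambda>x. if a x - b x = 0 then if b x - a x = 0 then f x else g x else g x)"
    by auto
  then show ?thesis using assms
    by (simp only:) (intro recursive_if_zero recursive_diff)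
qed

section \<open>Evaluation with bounded fuel\<close>

text \<open>
  An outcome is coded by a number: \<open>0\<close> for no result, \<open>Suc y\<close> for the result \<open>y\<close>.
  The state of the search is \<open>0\<close> while it is running, \<open>1\<close> if it has hit a missing result,
  and \<open>m + 2\<close> if it has found the first zero at \<open>m\<close>.
\<close>

definition search :: "(nat \<Rightarrow> nat) \<Rightarrow> nat \<Rightarrow> nat" where
  "search F n = rec_nat 0
    (\<lambda>i st. if st = 0 then if F i = 0 then 1 else if F i = 1 then Suc (Suc i) else 0 else st) n"

text \<open>In the coding of outcomes, \<open>1 < F i\<close> stands for a nonzero result and
  \<open>F i = 1\<close> for the result 0.\<close>

lemma search_eq_0_iff: "search F n = 0 \<longleftrightarrow> (\<forall>i<n. 1 < F i)"
  by (induction n) (auto simp: search_def less_Suc_eq)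

lemma search_eq_Suc_Suc_iff:
  "search F n = Suc (Suc m) \<longleftrightarrow> m < n \<and> F m = 1 \<and> (\<forall>i<m. 1 < F i)"
proof (induction n)
  case 0
  show ?case by (simp add: search_def)
next
  case (Suc n)
  have step: "search F (Suc n) = (if search F n = 0 then
      if F n = 0 then 1 else if F n = 1 then Suc (Suc n) else 0 else search F n)"
    by (simp add: search_def)
  show ?case
  proof (cases "search F n = 0")
    case True
    then show ?thesis
      using search_eq_0_iff[of F n] by (auto simp: step less_Suc_eq)
  next
    case False
    \<comment> \<open>Such a \<open>j\<close> has stopped the search before \<open>n\<close>, and it
      also rules out \<open>n\<close> as the first zero.\<close>
    then obtain j where "j < n" "\<not> 1 < F j"
      using search_eq_0_iff[of F n] by auto
    then show ?thesis using False Suc.IH by (auto simp: step less_Suc_eq)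
  qed
qed

text \<open>Fuel bounds only the searches of \<open>Mu\<close>; everything else follows the
  structure of the program. In the \<open>Mu\<close> clause, subtracting 1 turns the state
  \<open>m + 2\<close> into the outcome \<open>Suc m\<close> and both unsuccessful states into
  0.\<close>

primrec fuel_eval :: "prog \<Rightarrow> nat \<Rightarrow> nat \<Rightarrow> nat" where
  "fuel_eval Zero s x = Suc 0"
| "fuel_eval Succ s x = Suc (Suc x)"
| "fuel_eval Proj1 s x = Suc (pfst x)"
| "fuel_eval Proj2 s x = Suc (psnd x)"
| "fuel_eval (Tuple p q) s x =
    (if fuel_eval p s x = 0 then 0 else if fuel_eval q s x = 0 then 0
     else Suc (prod_encode (fuel_eval p s x - 1, fuel_eval q s x - 1)))"
| "fuel_eval (Comp p q) s x =
    (if fuel_eval q s x = 0 then 0 else fuel_eval p s (fuel_eval q s x - 1))"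
| "fuel_eval (PrimRec p q) s x = rec_nat (fuel_eval p s (pfst x))
    (\<lambda>i r. if r = 0 then 0 else fuel_eval q s (prod_encode (pfst x, prod_encode (i, r - 1))))
    (psnd x)"
| "fuel_eval (Mu p) s x = search (\<lambda>i. fuel_eval p s (prod_encode (x, i))) s - 1"

lemma fuel_eval_PrimRec_0 [simp]:
  "fuel_eval (PrimRec p q) s (prod_encode (a, 0)) = fuel_eval p s a"
  by simp

lemma fuel_eval_PrimRec_Suc [simp]:
  "fuel_eval (PrimRec p q) s (prod_encode (a, Suc n)) =
    (let r = fuel_eval (PrimRec p q) s (prod_encode (a, n)) in
     if r = 0 then 0 else fuel_eval q s (prod_encode (a, prod_encode (n, r - 1))))"
  by (simp add: Let_def cong del: if_weak_cong)

declare fuel_eval.simps(7) [simp del]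

lemma fuel_eval_Mu_iff:
  "fuel_eval (Mu p) s x = Suc m \<longleftrightarrow>
    m < s \<and> fuel_eval p s (prod_encode (x, m)) = 1 \<and>
    (\<forall>i<m. 1 < fuel_eval p s (prod_encode (x, i)))"
proof -
  have "k - 1 = Suc m \<longleftrightarrow> k = Suc (Suc m)" for k :: nat by auto
  then show ?thesis by (simp add: search_eq_Suc_Suc_iff)
qed

lemma fuel_eval_sound: "fuel_eval p s x = Suc y \<Longrightarrow> eval p x y"
proof (induction p arbitrary: x y)
  case (Tuple p q)
  then show ?case
    by (auto split: if_splits intro!: eval.Tuple)
next
  case (Comp p q)
  from Comp.prems obtain z where "fuel_eval q s x = Suc z" "fuel_eval p s z = Suc y"
    by (auto split: if_splits simp: gr0_conv_Suc)
  then show ?case using Comp.IH by (blast intro: eval.Comp)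
next
  case (PrimRec p q)
  obtain a n where x: "x = prod_encode (a, n)"
    by (metis prod.collapse prod_decode_inverse)
  show ?case
    using PrimRec.prems unfolding x
  proof (induction n arbitrary: y)
    case 0
    then show ?case using PrimRec.IH(1) by (auto intro: eval.PrimRec_0)
  next
    case (Suc n)
    define r where "r = fuel_eval (PrimRec p q) s (prod_encode (a, n))"
    from Suc.prems have "r \<noteq> 0"
      and "fuel_eval q s (prod_encode (a, prod_encode (n, r - 1))) = Suc y"
      by (auto simp: r_def Let_def split: if_splits)
    moreover from \<open>r \<noteq> 0\<close> have "eval (PrimRec p q) (prod_encode (a, n)) (r - 1)"
      by (intro Suc.IH) (simp add: r_def)
    ultimately show ?case using PrimRec.IH(2) by (blast intro: eval.PrimRec_Suc)
  qed
next
  case (Mu p)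
  from Mu.prems have zero: "fuel_eval p s (prod_encode (x, y)) = Suc 0"
    and pos: "\<And>i. i < y \<Longrightarrow> 1 < fuel_eval p s (prod_encode (x, i))"
    unfolding fuel_eval_Mu_iff by auto
  have "\<exists>z. eval p (prod_encode (x, i)) (Suc z)" if "i < y" for i
    using pos[OF that] Mu.IH by (metis One_nat_def less_imp_Suc_add plus_1_eq_Suc)
  then show ?case using Mu.IH[OF zero] by (blast intro: eval.Mu)
qed (auto intro: eval.Zero eval.Succ eval_Proj1 eval_Proj2)

text \<open>More fuel only lengthens searches. Results already obtained persist, so a first zero
  remains the first.\<close>

lemma fuel_eval_mono:
  "fuel_eval p s x = Suc y \<Longrightarrow> s \<le> t \<Longrightarrow> fuel_eval p t x = Suc y"
proof (induction p arbitrary: x y)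
  case (Tuple p q)
  from Tuple.prems obtain a b where "fuel_eval p s x = Suc a" "fuel_eval q s x = Suc b"
    by (auto split: if_splits simp: gr0_conv_Suc)
  with Tuple show ?case by auto
next
  case (Comp p q)
  from Comp.prems obtain a where "fuel_eval q s x = Suc a"
    by (auto split: if_splits simp: gr0_conv_Suc)
  with Comp show ?case by auto
next
  case (PrimRec p q)
  obtain a n where x: "x = prod_encode (a, n)"
    by (metis prod.collapse prod_decode_inverse)
  show ?case
    using PrimRec.prems(1) unfolding x
  proof (induction n arbitrary: y)
    case 0
    then show ?case using PrimRec.IH(1) PrimRec.prems(2) by auto
  next
    case (Suc n)
    from Suc.prems obtain r where "fuel_eval (PrimRec p q) s (prod_encode (a, n)) = Suc r"
      and "fuel_eval q s (prod_encode (a, prod_encode (n, r))) = Suc y"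
      by (auto simp: Let_def split: if_splits simp: gr0_conv_Suc)
    with Suc.IH PrimRec.IH(2) PrimRec.prems(2) show ?case by fastforce
  qed
next
  case (Mu p)
  have "1 < fuel_eval p t (prod_encode (x, i))" if "1 < fuel_eval p s (prod_encode (x, i))" for i
    using that Mu.IH Mu.prems(2) by (metis One_nat_def less_imp_Suc_add)
  with Mu show ?case unfolding fuel_eval_Mu_iff by auto
qed auto

text \<open>Each rule uses finitely many evaluations, and by monotonicity one common bound on their
  fuels serves them all.\<close>

lemma fuel_eval_complete: "eval p x y \<Longrightarrow> \<exists>s. fuel_eval p s x = Suc y"
proof (induction rule: eval.induct)
  case (Tuple p x y q z)
  then obtain s t where "fuel_eval p s x = Suc y" "fuel_eval q t x = Suc z" by blast
  then have "fuel_eval p (max s t) x = Suc y" "fuel_eval q (max s t) x = Suc z"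
    by (auto intro: fuel_eval_mono)
  then show ?case by (intro exI[of _ "max s t"]) simp
next
  case (Comp q x y p z)
  then obtain s t where "fuel_eval q s x = Suc y" "fuel_eval p t y = Suc z" by blast
  then have "fuel_eval q (max s t) x = Suc y" "fuel_eval p (max s t) y = Suc z"
    by (auto intro: fuel_eval_mono)
  then show ?case by (intro exI[of _ "max s t"]) simp
next
  case (PrimRec_Suc p q x n r y)
  let ?w = "prod_encode (x, n)" and ?v = "prod_encode (x, prod_encode (n, r))"
  from PrimRec_Suc obtain s t
    where "fuel_eval (PrimRec p q) s ?w = Suc r" "fuel_eval q t ?v = Suc y" by blast
  then have "fuel_eval (PrimRec p q) (max s t) ?w = Suc r" "fuel_eval q (max s t) ?v = Suc y"
    by (blast intro: fuel_eval_mono max.cobounded1 max.cobounded2)+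
  then have "fuel_eval (PrimRec p q) (max s t) (prod_encode (x, Suc n)) = Suc y"
    by simp
  then show ?case ..
next
  case (Mu p x m)
  from Mu.IH(2) obtain z t
    where t: "\<And>i. i < m \<Longrightarrow> fuel_eval p (t i) (prod_encode (x, i)) = Suc (Suc (z i))"
    by metis
  obtain s where s: "fuel_eval p s (prod_encode (x, m)) = Suc 0" using Mu.IH(1) by blast
  \<comment> \<open>\<open>Suc m\<close> lets the search reach \<open>m\<close>, \<open>s\<close>
    suffices for the zero there, and the sum dominates every \<open>t i\<close>.\<close>
  define u where "u = Suc m + s + (\<Sum>i<m. t i)"
  have "fuel_eval p u (prod_encode (x, m)) = 1"
    using fuel_eval_mono[OF s, of u] by (simp add: u_def)
  moreover have "1 < fuel_eval p u (prod_encode (x, i))" if "i < m" for i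
  proof -
    have "t i \<le> (\<Sum>i<m. t i)" using that by (intro member_le_sum) auto
    then show ?thesis using fuel_eval_mono[OF t[OF that], of u] by (simp add: u_def)
  qed
  ultimately have "fuel_eval (Mu p) u x = Suc m"
    unfolding fuel_eval_Mu_iff by (simp add: u_def)
  then show ?case ..
qed auto

text \<open>Here \<open>p\<close> is fixed and not an input, so the function is assembled along its
  structure; \<open>s\<close> and \<open>x\<close> are generalized because subprograms run on other
  inputs.\<close>

lemma recursive_fuel_eval [recursive_intros]:
  "recursive s \<Longrightarrow> recursive x \<Longrightarrow> recursive (\<lambda>w. fuel_eval p (s w) (x w))"
proof (induction p arbitrary: s x)
  case (Comp p q)
  then show ?case unfolding fuel_eval.simps by (intro recursive_intros Comp.IH)
next
  case (PrimRec p q)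
  have "recursive (\<lambda>w. s (pfst w))" "recursive (\<lambda>w. x (pfst w))"
    using PrimRec.prems by (simp_all add: recursive_compose_pfst)
  with PrimRec show ?case unfolding fuel_eval.simps by (intro recursive_intros PrimRec.IH)
next
  case (Mu p)
  have "recursive (\<lambda>w. s (pfst w))" "recursive (\<lambda>w. x (pfst w))"
    using Mu.prems by (simp_all add: recursive_compose_pfst)
  with Mu show ?case unfolding fuel_eval.simps search_def by (intro recursive_intros Mu.IH)
qed (auto intro!: recursive_intros)

section \<open>Self-reference\<close>

primrec const_prog :: "nat \<Rightarrow> prog" where
  "const_prog 0 = Zero"
| "const_prog (Suc n) = Comp Succ (const_prog n)"

lemma eval_const_prog: "eval (const_prog n) x n"
  by (induction n) (auto intro: eval.intros)

lemma recursive_goedel_const_prog [recursive_intros]: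
  assumes "recursive f"
  shows "recursive (\<lambda>x. goedel (const_prog (f x)))"
proof -
  have "goedel (const_prog n) =
      rec_nat (goedel Zero) (\<lambda>i r. prod_encode (5, prod_encode (goedel Succ, r))) n" for n
    by (induction n) simp_all
  then show ?thesis using assms by (auto intro!: recursive_intros)
qed

definition specialize :: "prog \<Rightarrow> nat \<Rightarrow> prog" where
  "specialize q e = Comp q (Tuple (const_prog e) Ident)"

lemma computes_specialize:
  "computes q F \<Longrightarrow> computes (specialize q e) (\<lambda>x. F (prod_encode (e, x)))"
  unfolding computes_def specialize_def
  by (meson eval.Comp eval.Tuple eval_const_prog eval_Ident)

text \<open>The effect of \<open>specialize\<close> on codes, which a program can compute; 5 and 4
  are the tags of \<open>Comp\<close> and \<open>Tuple\<close>.\<close>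

definition specialize_code :: "nat \<Rightarrow> nat \<Rightarrow> nat" where
  "specialize_code c e = prod_encode (5, prod_encode (c, prod_encode (4,
    prod_encode (goedel (const_prog e), goedel Ident))))"

lemma goedel_specialize: "goedel (specialize q e) = specialize_code (goedel q) e"
  by (simp add: specialize_def specialize_code_def)

lemma recursive_specialize_code [recursive_intros]:
  "recursive f \<Longrightarrow> recursive g \<Longrightarrow> recursive (\<lambda>x. specialize_code (f x) (g x))"
  unfolding specialize_code_def by (intro recursive_intros)

text \<open>
  Both programs may use the pair \<open>c\<close> of both of their codes: it is computed from the parameter
  of the specialization, which is the pair of the codes of the unspecialized programs.
\<close>

lemma recursion_theorem2:
  assumes "recursive F" and "recursive G"
  obtains p q c where "c = prod_encode (goedel p, goedel q)"
    and "computes p (\<lambda>x. F (prod_encode (c, x)))"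
    and "computes q (\<lambda>x. G (prod_encode (c, x)))"
proof -
  define code where
    "code e = prod_encode (specialize_code (pfst e) e, specialize_code (psnd e) e)" for e
  have code: "recursive (\<lambda>w. prod_encode (code (pfst w), psnd w))"
    unfolding code_def by (intro recursive_intros)
  obtain P Q where P: "computes P (\<lambda>w. F (prod_encode (code (pfst w), psnd w)))"
    and Q: "computes Q (\<lambda>w. G (prod_encode (code (pfst w), psnd w)))"
    using recursive_compose[OF assms(1) code] recursive_compose[OF assms(2) code]
    unfolding recursive_def by blast
  \<comment> \<open>The fixed point: \<open>P\<close> and \<open>Q\<close> are specialized to their
    own pair of codes, so \<open>code e\<close> yields the codes of the two specialized
    programs.\<close>
  define e where "e = prod_encode (goedel P, goedel Q)"
  show thesis
  proof (rule that)
    show "code e = prod_encode (goedel (specialize P e), goedel (specialize Q e))"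
      by (simp add: code_def goedel_specialize e_def)
    show "computes (specialize P e) (\<lambda>x. F (prod_encode (code e, x)))"
      using computes_specialize[OF P] by simp
    show "computes (specialize Q e) (\<lambda>x. G (prod_encode (code e, x)))"
      using computes_specialize[OF Q] by simp
  qed
qed

section \<open>Involutions\<close>

text \<open>An involution is its own inverse, so its iterates in both directions alternate between
  the identity and \<open>f\<close>.\<close>

lemma cycle_equiv_involution:
  assumes "\<And>x. f (f x) = x"
  shows "cycle_equiv f x y \<longleftrightarrow> y = x \<or> y = f x"
proof
  have "inv f = f" using assms by (intro inv_equality) auto
  moreover have "(f ^^ n) x = x \<or> (f ^^ n) x = f x" for n
    by (induction n) (auto simp: assms)
  ultimately show "y = x \<or> y = f x" if "cycle_equiv f x y"
    using that by (auto simp: cycle_equiv_def int_iter_def split: if_splits)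
  show "cycle_equiv f x y" if "y = x \<or> y = f x"
  proof -
    have "x = int_iter f 0 x" "f x = int_iter f 1 x" by (simp_all add: int_iter_def)
    with that show ?thesis unfolding cycle_equiv_def by blast
  qed
qed

lemma decides_cycle_equiv_involution:
  assumes "\<And>x. f (f x) = x"
    and "computes d (\<lambda>w. if psnd w = pfst w then 1 else if psnd w = f (pfst w) then 1 else 0)"
  shows "decides d (cycle_equiv f)"
  unfolding decides_def
proof (intro allI)
  fix x y
  show "eval d (prod_encode (x, y)) (of_bool (cycle_equiv f x y))"
    using assms(2)[unfolded computes_def, rule_format, of "prod_encode (x, y)"]
    by (cases "y = x"; cases "y = f x") (auto simp: cycle_equiv_involution[OF assms(1)])
qed

lemma involution_in_rec_perms:
  assumes "\<And>x. f (f x) = x" and "recursive f"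
  shows "f \<in> rec_perms"
  using assms by (auto simp: rec_perms_def fun_eq_iff intro!: o_bij[of f f])

lemma id_in_rec_perms: "id \<in> rec_perms"
  by (rule involution_in_rec_perms) (auto simp: id_def intro: recursive_intros)

lemma id_in_Perm: "id \<in> Perm"
proof -
  have "recursive (\<lambda>w. if psnd w = pfst w then 1 else if psnd w = id (pfst w) then 1 else 0)"
    unfolding id_def by (intro recursive_intros)
  then show ?thesis
    unfolding Perm_def recursive_def
    using id_in_rec_perms decides_cycle_equiv_involution[of id] by auto
qed

text \<open>A conjugate of the identity is \<open>inv h \<circ> h\<close>, which collapses because
  \<open>h\<close> is injective.\<close>

lemma rec_conj_id_iff: "rec_conj f id \<longleftrightarrow> f = id"
proof
  show "f = id" if "rec_conj f id"
    using that by (auto simp: rec_conj_def rec_perms_def bij_is_inj)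
  show "rec_conj f id" if "f = id"
    unfolding rec_conj_def using that id_in_rec_perms by (intro bexI[of _ id]) auto
qed

section \<open>Diagonalization against a claimed algorithm\<close>

definition swap_block :: "nat \<Rightarrow> nat" where
  "swap_block x = prod_encode (pfst x, prod_encode (psnd (psnd x), pfst (psnd x)))"

lemma swap_block_swap_block: "swap_block (swap_block x) = x"
  by (simp add: swap_block_def)

text \<open>The first component is the block number. As blocks are invariant, swapping in any
  selection of blocks is still an involution.\<close>

lemma pfst_swap_block: "pfst (swap_block x) = pfst x"
  by (simp add: swap_block_def)

lemma recursive_swap_block [recursive_intros]:
  "recursive f \<Longrightarrow> recursive (\<lambda>x. swap_block (f x))"
  unfolding swap_block_def by (intro recursive_intros)

lemma not_solves_Conj_id: "\<not> solves_Conj A id"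
proof
  assume A: "solves_Conj A id"
  \<comment> \<open>\<open>Suc 1\<close> codes the answer "conjugate". The block number of
    \<open>x\<close> acts as fuel, and \<open>c\<close> will be the pair of codes of the programs
    for \<open>F c\<close> and \<open>G c\<close>.\<close>
  define F where
    "F c x = (if fuel_eval A (pfst x) c = Suc 1 then swap_block x else x)" for c x
  define G where
    "G c w = (if psnd w = pfst w then 1 else if psnd w = F c (pfst w) then 1 else 0 :: nat)" for c w
  have F: "recursive (\<lambda>w. F (pfst w) (psnd w))"
    and G: "recursive (\<lambda>w. G (pfst w) (psnd w))"
    unfolding F_def G_def by (intro recursive_intros)+
  obtain p d c where c: "c = prod_encode (goedel p, goedel d)"
    and p: "computes p (F c)" and d: "computes d (G c)"
    by (rule recursion_theorem2[OF F G]) simp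
  have invol: "F c (F c x) = x" for x
    by (simp add: F_def swap_block_swap_block pfst_swap_block)
  have dec: "decides d (cycle_equiv (F c))"
    using invol d unfolding G_def by (rule decides_cycle_equiv_involution)
  have "F c \<in> Perm"
    using involution_in_rec_perms[OF invol] p dec unfolding Perm_def recursive_def by blast
  \<comment> \<open>Since \<open>c\<close> satisfies the promise, \<open>A\<close> must answer
    correctly on it.\<close>
  then have answer: "eval A c (of_bool (F c = id))"
    using A p dec unfolding solves_Conj_def c rec_conj_id_iff by blast
  show False
  proof (cases "F c = id")
    case True
    then obtain s where "fuel_eval A s c = Suc 1"
      using answer fuel_eval_complete by fastforce
    \<comment> \<open>Any point of block \<open>s\<close> with distinct inner coordinates is moved;
      (0, 1) is one.\<close>
    then have "F c (prod_encode (s, prod_encode (0, 1))) = prod_encode (s, prod_encode (1, 0))"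
      by (simp add: F_def swap_block_def)
    then show False using True by simp
  next
    case False
    then obtain x where "F c x \<noteq> x" by (auto simp: fun_eq_iff)
    \<comment> \<open>A point is moved only in a block whose fuel sufficed for the answer 1, whereas
      the correct answer here is 0.\<close>
    then have "eval A c 1"
      by (auto simp: F_def split: if_splits intro: fuel_eval_sound)
    then show False using answer False eval_deterministic by fastforce
  qed
qed

theorem theorem4p8:
  "\<exists>g \<in> Perm. \<not> (\<exists>A. solves_Conj A g)"
  using id_in_Perm not_solves_Conj_id by blast

end
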